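(* Let $\pi:\Pi\to\Gamma$ be a projective GKM fiber bundle with fiber $K_{r+1}$, where $\Pi=(P,\alpha^P,\nabla^P)$ and $\Gamma=(G,\alpha,\nabla)$ are GKM graphs. Assume that $\Pi$ has a $\nabla^P$-invariant subgraph $\Pi'$ which is a degree $1$ cover of $\Gamma$ for the projection $\pi$, i.e. there is a section $\sigma:\Gamma\to\Pi$ of $\pi$ and $\Pi'=\Gamma$ is identified with its image. Then there exists a rank $r+1$ leg bundle $\xi$ over $\Gamma$ such that $\Pi\to\Gamma$ is equal to the projectivization $\Pi(\xi)\to\Gamma$ (after identifying the vertex set of each fiber $\pi^{-1}(p)$ with $\{p\}\times[r+1]$).
   Context: **Graphs.** A graph $G=(\mathcal V,\mathcal E)$ is finite and connected, with oriented, possibly multiple edges; $i(e),t(e)$ are the initial and terminal vertices of $e$, $\overline e\in\mathcal E$ is the reversed edge, $\mathrm{star}_G(p)=\{e: i(e)=p\}$. $G$ is $m$-valent if all stars have $m$ elements. $[k]=\{1,\dots,k\}$. $(\mathfrak t^n_{\mathbb Z})^*=\mathrm{Hom}(T^n,S^1)\simeq\mathbb Z^n$; $a\equiv b\bmod c$ means $a-b\in\mathbb Zc$. **GKM graph.** An ($(m,n)$-type, $n\le m$) GKM graph $\Gamma=(G,\alpha,\nabla)$ is an $m$-valent graph with an axial function $\alpha:\mathcal E\to(\mathfrak t^n_{\mathbb Z})^*$ and a connection $\nabla=\{\nabla_e:\mathrm{star}_G(i(e))\to\mathrm{star}_G(t(e))\}$ of bijections such that: (1) $\alpha(e)=\pm\alpha(\overline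 e)$; (2) for every $p$, the labels of any two distinct edges in $\mathrm{star}_G(p)$ are linearly independent (2-independence); (3) $\nabla_{\overline e}=\nabla_e^{-1}$, $\nabla_e(e)=\overline e$, and $\alpha(\nabla_e(e'))-\alpha(e')\equiv0\bmod\alpha(e)$ for all $e,e'$ with the same initial vertex. **Graph fibration.** A graph morphism $\pi:P\to G$ maps vertices to vertices, and for each edge $e$ of $P$ either $\pi(i(e))=\pi(t(e))=\pi(e)$ is a vertex ($e$ is vertical) or $\pi(e)$ is an edge with $\pi(i(e))=i(\pi(e))$ ($e$ is horizontal); it is compatible with edge reversal. For a vertex $x$ of $P$, $\mathcal H_x$ is the set of horizontal edges starting at $x$. $\pi$ is a graph fibration if $\mathcal H_x\to\mathrm{star}_G(\pi(x))$ is bijective for every vertex $x$ of $P$. A lift of $e$ is an edge $\widetilde e$ with $\pi(\widetilde e)=e$. **GKM fibration.** $\pi:\Pi=(P,\alpha^P,\nabla^P)\to\Gamma=(G,\alpha,\nabla)$ (both with labels in the same lattice) is a GKM fibration if: (i) $\pi:P\to G$ is a graph fibration; (ii) $\alpha^P(\widetilde e)=\alpha(e)$ for each lift $\widetilde e$ of $e$; (iii) $\nabla^P$ sends vertical edges to vertical edges and horizontal edges to horizontal edges; (iv) on horizontal edges $\nabla^P$ covers $\nabla$: for an edge $\epsilon$ starting at $x$ and $h\in\mathcal H_x$, $\pi(\nabla^P_\epsilon(h))=\nabla_{\pi(\epsilon)}(\pi(h))$ if $\epsilon$ is horizontal, and $\pi(\nabla^P_\epsilon(h))=\pi(h)$ if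 $\epsilon$ is vertical. **GKM fiber bundle.** For $e\in\mathcal E^G$ let $\Phi_e$ map a vertex $x\in\pi^{-1}(i(e))$ to $t(\widetilde e)$, where $\widetilde e$ is the lift of $e$ starting at $x$. For a vertex $q$ of $G$, $\Pi_q$ is the subgraph $\pi^{-1}(q)$ with the restricted labels and connection, and $\mathfrak t_q$ is the $\mathbb Z$-span of its labels. A GKM fibration is a GKM fiber bundle if for every $e\in\mathcal E^G$: $\Phi_e$ induces an isomorphism of graphs $\pi^{-1}(i(e))\to\pi^{-1}(t(e))$; $\Phi_e$ is compatible with $\nabla^P$ (so $\nabla^P_{\widetilde e}(\epsilon)=\Phi_e(\epsilon)$ for a lift $\widetilde e$ of $e$ and a vertical edge $\epsilon$ starting at $i(\widetilde e)$); and $\Phi_e$ induces an isomorphism of GKM graphs $\Pi_{i(e)}\to\Pi_{t(e)}$ up to a linear isomorphism $\Psi_e:\mathfrak t_{i(e)}\to\mathfrak t_{t(e)}$. **Projective GKM fiber bundle.** A GKM fiber bundle is projective (with fiber $K_{r+1}$) if its fiber is a GKM graph on the complete graph $K_{r+1}$ with vertex set $[r+1]$ and with the standard connection (moving along the edge $jk$ sends $jl$ to $kl$ for distinct $j,k,l$), and, writing $(p,jk)$ for the edge from $(p,j)$ to $(p,k)$ in $\pi^{-1}(p)$ with vertices $(p,1),\dots,(p,r+1)$, one has $$\alpha^P(p,jk)=\alpha^P(p,jl)-\alpha^P(p,kl),\qquad j,k,l\in[r+1],$$ for every $p$, with the convention $\alpha^P(p,jj)=0$. **Invariant subgraph.**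 The subgraph $\Pi'$ contains exactly one vertex over each vertex of $G$ and exactly one edge, a lift, over each edge of $G$ (so $\pi$ restricts to an isomorphism from $\Pi'$ onto $G$), and for every edge $\epsilon$ of $\Pi'$, $\nabla^P_\epsilon$ maps edges of $\Pi'$ to edges of $\Pi'$. **Leg bundle.** A rank $k$ leg bundle $\xi$ over $\Gamma$ consists of weights $\xi_p^j\in(\mathfrak t^n_{\mathbb Z})^*$ ($p\in\mathcal V$, $j\in[k]$) and bijections $\sigma_e:[k]\to[k]$ ($e\in\mathcal E$), from the legs over $i(e)$ to the legs over $t(e)$, with $\sigma_{\overline e}=\sigma_e^{-1}$ and $\xi_{t(e)}^{\sigma_e(j)}-\xi_{i(e)}^j\equiv0\bmod\alpha(e)$. **Projectivization.** For a rank $r+1$ leg bundle $\xi$, $\Pi(\xi)=(P(\xi),\alpha^{P(\xi)},\nabla^{P(\xi)})$ has vertices $\mathcal V\times[r+1]$; vertical edges $(p,jk)$ from $(p,j)$ to $(p,k)$ ($j\ne k$), with label $\xi_p^k-\xi_p^j$ and reversal $(p,kj)$; horizontal edges $(e,l)$ from $(i(e),l)$ to $(t(e),\sigma_e(l))$, with label $\alpha(e)$ and reversal $(\overline e,\sigma_e(l))$; and connection $\nabla_\epsilon(\epsilon)=\overline\epsilon$, $\nabla_{(u,jk)}(u,jl)=(u,kl)$, $\nabla_{(u,jk)}(e,j)=(e,k)$ for $i(e)=u$, $\nabla_{(e,l)}(u,lk)=(v,\sigma_e(l)\sigma_e(k))$ for $i(e)=u,t(e)=v$, $\nabla_{(e,l)}(e',l)=(\nabla_e(e'),\sigma_e(l))$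 for $i(e)=i(e')$. The projection $\Pi(\xi)\to\Gamma$ sends $(p,j)\mapsto p$, $(p,jk)\mapsto p$, $(e,l)\mapsto e$. *)

theory Defs
  imports
    "HOL-Analysis.Finite_Cartesian_Product"
    "Graph_Theory.Graph_Theory"
begin

section \<open>The label lattice\<close>

text \<open>
  Labels live in \<open>int ^ 'n\<close>, which stands for the weight lattice of the torus of
  dimension \<open>CARD('n)\<close>.
\<close>

interpretation lattice: module "(*s) :: int \<Rightarrow> int ^ 'n \<Rightarrow> int ^ 'n"
  by unfold_locales
    (simp_all add: vector_add_ldistrib vector_sadd_rdistrib vector_smult_assoc)

definition cong_mod :: "int ^ 'n \<Rightarrow> int ^ 'n \<Rightarrow> int ^ 'n \<Rightarrow> bool" where
  "cong_mod a b c \<longleftrightarrow> (\<exists>k. a - b = k *s c)"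

text \<open>The clause \<open>a \<noteq> b\<close> is needed because \<open>{a, a}\<close> collapses to a singleton.\<close>

definition independent_pair :: "int ^ 'n \<Rightarrow> int ^ 'n \<Rightarrow> bool" where
  "independent_pair a b \<longleftrightarrow> a \<noteq> b \<and> lattice.independent {a, b}"

definition lattice_iso ::
  "(int ^ 'n \<Rightarrow> int ^ 'n) \<Rightarrow> (int ^ 'n) set \<Rightarrow> (int ^ 'n) set \<Rightarrow> bool" where
  "lattice_iso \<Psi> A B \<longleftrightarrow> bij_betw \<Psi> A B \<and>
     (\<forall>x\<in>A. \<forall>y\<in>A. \<Psi> (x + y) = \<Psi> x + \<Psi> y) \<and>
     (\<forall>k. \<forall>x\<in>A. \<Psi> (k *s x) = k *s \<Psi> x)"


section \<open>GKM graphs\<close>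

text \<open>
  Arcs are oriented edges, \<open>tail\<close> and \<open>head\<close> are initial and terminal vertex, and
  \<open>conn \<Gamma> e\<close> is the bijection \<open>\<nabla>\<^sub>e\<close>. All functions matter on the vertices and arcs of the
  graph only.
\<close>

record ('v, 'e, 'n) gkm_data =
  dgr :: "('v, 'e) pre_digraph"
  rev_arc :: "'e \<Rightarrow> 'e"
  axial :: "'e \<Rightarrow> int ^ 'n"
  conn :: "'e \<Rightarrow> 'e \<Rightarrow> 'e"

abbreviation "Vs \<Gamma> \<equiv> verts (dgr \<Gamma>)"
abbreviation "Es \<Gamma> \<equiv> arcs (dgr \<Gamma>)"
abbreviation "ini \<Gamma> \<equiv> tail (dgr \<Gamma>)"
abbreviation "ter \<Gamma> \<equiv> head (dgr \<Gamma>)"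
abbreviation "star \<Gamma> p \<equiv> out_arcs (dgr \<Gamma>) p"

locale gkm_graph = fin_digraph "dgr \<Gamma>"
  for \<Gamma> :: "('v, 'e, 'n::finite) gkm_data" and m :: nat +
  assumes connected: "Digraph_Component.connected (dgr \<Gamma>)"
    and rev_in: "e \<in> Es \<Gamma> \<Longrightarrow> rev_arc \<Gamma> e \<in> Es \<Gamma>"
    and rev_rev: "e \<in> Es \<Gamma> \<Longrightarrow> rev_arc \<Gamma> (rev_arc \<Gamma> e) = e"
    and ini_rev: "e \<in> Es \<Gamma> \<Longrightarrow> ini \<Gamma> (rev_arc \<Gamma> e) = ter \<Gamma> e"
    and ter_rev: "e \<in> Es \<Gamma> \<Longrightarrow> ter \<Gamma> (rev_arc \<Gamma> e) = ini \<Gamma> e"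
    and valent: "p \<in> Vs \<Gamma> \<Longrightarrow> card (star \<Gamma> p) = m"
    and dim_le: "CARD('n) \<le> m"
    and axial_rev: "e \<in> Es \<Gamma> \<Longrightarrow>
      axial \<Gamma> e = axial \<Gamma> (rev_arc \<Gamma> e) \<or> axial \<Gamma> e = - axial \<Gamma> (rev_arc \<Gamma> e)"
    and two_independent: "\<lbrakk>p \<in> Vs \<Gamma>; e \<in> star \<Gamma> p; e' \<in> star \<Gamma> p; e \<noteq> e'\<rbrakk> \<Longrightarrow>
      independent_pair (axial \<Gamma> e) (axial \<Gamma> e')"
    and conn_bij: "e \<in> Es \<Gamma> \<Longrightarrow>
      bij_betw (conn \<Gamma> e) (star \<Gamma> (ini \<Gamma> e)) (star \<Gamma> (ter \<Gamma> e))"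
    and conn_rev: "\<lbrakk>e \<in> Es \<Gamma>; e' \<in> star \<Gamma> (ini \<Gamma> e)\<rbrakk> \<Longrightarrow>
      conn \<Gamma> (rev_arc \<Gamma> e) (conn \<Gamma> e e') = e'"
    and conn_self: "e \<in> Es \<Gamma> \<Longrightarrow> conn \<Gamma> e e = rev_arc \<Gamma> e"
    and conn_cong: "\<lbrakk>e \<in> Es \<Gamma>; e' \<in> star \<Gamma> (ini \<Gamma> e)\<rbrakk> \<Longrightarrow>
      cong_mod (axial \<Gamma> (conn \<Gamma> e e')) (axial \<Gamma> e') (axial \<Gamma> e)"

definition graph_iso ::
  "('v, 'e, 'n::finite) gkm_data \<Rightarrow> ('w, 'f, 'n::finite) gkm_data \<Rightarrow> ('v \<Rightarrow> 'w) \<Rightarrow> ('e \<Rightarrow> 'f) \<Rightarrow> bool" where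
  "graph_iso \<Gamma> \<Delta> f g \<longleftrightarrow>
     bij_betw f (Vs \<Gamma>) (Vs \<Delta>) \<and> bij_betw g (Es \<Gamma>) (Es \<Delta>) \<and>
     (\<forall>e\<in>Es \<Gamma>. ini \<Delta> (g e) = f (ini \<Gamma> e) \<and> ter \<Delta> (g e) = f (ter \<Gamma> e) \<and>
        g (rev_arc \<Gamma> e) = rev_arc \<Delta> (g e))"

text \<open>Isomorphism of GKM graphs, with the labels transformed by \<open>\<Psi>\<close>.\<close>

definition gkm_iso ::
  "(int ^ 'n \<Rightarrow> int ^ 'n) \<Rightarrow> ('v, 'e, 'n::finite) gkm_data \<Rightarrow> ('w, 'f, 'n::finite) gkm_data \<Rightarrow>
   ('v \<Rightarrow> 'w) \<Rightarrow> ('e \<Rightarrow> 'f) \<Rightarrow> bool" where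
  "gkm_iso \<Psi> \<Gamma> \<Delta> f g \<longleftrightarrow> graph_iso \<Gamma> \<Delta> f g \<and>
     (\<forall>e\<in>Es \<Gamma>. axial \<Delta> (g e) = \<Psi> (axial \<Gamma> e)) \<and>
     (\<forall>e\<in>Es \<Gamma>. \<forall>e'\<in>star \<Gamma> (ini \<Gamma> e). g (conn \<Gamma> e e') = conn \<Delta> (g e) (g e'))"


section \<open>GKM fibrations and GKM fiber bundles\<close>

text \<open>A vertical edge is sent to a vertex (\<open>Inl\<close>), a horizontal edge to an edge (\<open>Inr\<close>).\<close>

record ('w, 'f, 'v, 'e) graph_map =
  vmap :: "'w \<Rightarrow> 'v"
  emap :: "'f \<Rightarrow> 'v + 'e"

definition vertical :: "('w, 'f, 'v, 'e) graph_map \<Rightarrow> 'f \<Rightarrow> bool" where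
  "vertical \<pi> \<epsilon> \<longleftrightarrow> (\<exists>q. emap \<pi> \<epsilon> = Inl q)"

definition horizontal :: "('w, 'f, 'v, 'e) graph_map \<Rightarrow> 'f \<Rightarrow> bool" where
  "horizontal \<pi> \<epsilon> \<longleftrightarrow> (\<exists>e. emap \<pi> \<epsilon> = Inr e)"

definition graph_morphism ::
  "('w, 'f, 'n::finite) gkm_data \<Rightarrow> ('v, 'e, 'n::finite) gkm_data \<Rightarrow> ('w, 'f, 'v, 'e) graph_map \<Rightarrow> bool" where
  "graph_morphism P \<Gamma> \<pi> \<longleftrightarrow>
     (\<forall>x\<in>Vs P. vmap \<pi> x \<in> Vs \<Gamma>) \<and>
     (\<forall>\<epsilon>\<in>Es P.
        (emap \<pi> \<epsilon> = Inl (vmap \<pi> (ini P \<epsilon>)) \<and> vmap \<pi> (ter P \<epsilon>) = vmap \<pi> (ini P \<epsilon>)) \<or>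
        (\<exists>e\<in>Es \<Gamma>. emap \<pi> \<epsilon> = Inr e \<and> vmap \<pi> (ini P \<epsilon>) = ini \<Gamma> e)) \<and>
     (\<forall>\<epsilon>\<in>Es P. emap \<pi> (rev_arc P \<epsilon>) = map_sum id (rev_arc \<Gamma>) (emap \<pi> \<epsilon>))"

definition horizontal_star ::
  "('w, 'f, 'n::finite) gkm_data \<Rightarrow> ('w, 'f, 'v, 'e) graph_map \<Rightarrow> 'w \<Rightarrow> 'f set" where
  "horizontal_star P \<pi> x = {h \<in> star P x. horizontal \<pi> h}"

definition graph_fibration ::
  "('w, 'f, 'n::finite) gkm_data \<Rightarrow> ('v, 'e, 'n::finite) gkm_data \<Rightarrow> ('w, 'f, 'v, 'e) graph_map \<Rightarrow> bool" where
  "graph_fibration P \<Gamma> \<pi> \<longleftrightarrow> graph_morphism P \<Gamma> \<pi> \<and>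
     (\<forall>x\<in>Vs P. bij_betw (emap \<pi>) (horizontal_star P \<pi> x) (Inr ` star \<Gamma> (vmap \<pi> x)))"

locale gkm_fibration = total: gkm_graph P m' + base: gkm_graph \<Gamma> m
  for P :: "('w, 'f, 'n::finite) gkm_data" and m' :: nat
    and \<Gamma> :: "('v, 'e, 'n) gkm_data" and m :: nat +
  fixes \<pi> :: "('w, 'f, 'v, 'e) graph_map"
  assumes fibration: "graph_fibration P \<Gamma> \<pi>"
    and axial_lift: "\<lbrakk>\<epsilon> \<in> Es P; emap \<pi> \<epsilon> = Inr e\<rbrakk> \<Longrightarrow> axial P \<epsilon> = axial \<Gamma> e"
    and conn_vertical: "\<lbrakk>\<epsilon> \<in> Es P; \<epsilon>' \<in> star P (ini P \<epsilon>); vertical \<pi> \<epsilon>'\<rbrakk> \<Longrightarrow>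
      vertical \<pi> (conn P \<epsilon> \<epsilon>')"
    and conn_horizontal: "\<lbrakk>\<epsilon> \<in> Es P; h \<in> star P (ini P \<epsilon>); horizontal \<pi> h\<rbrakk> \<Longrightarrow>
      horizontal \<pi> (conn P \<epsilon> h)"
    and conn_covers_horizontal:
      "\<lbrakk>\<epsilon> \<in> Es P; h \<in> star P (ini P \<epsilon>); emap \<pi> \<epsilon> = Inr e; emap \<pi> h = Inr e'\<rbrakk> \<Longrightarrow>
        emap \<pi> (conn P \<epsilon> h) = Inr (conn \<Gamma> e e')"
    and conn_covers_vertical:
      "\<lbrakk>\<epsilon> \<in> Es P; h \<in> star P (ini P \<epsilon>); vertical \<pi> \<epsilon>; horizontal \<pi> h\<rbrakk> \<Longrightarrow>
        emap \<pi> (conn P \<epsilon> h) = emap \<pi> h"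

definition lift_at ::
  "('w, 'f, 'n::finite) gkm_data \<Rightarrow> ('w, 'f, 'v, 'e) graph_map \<Rightarrow> 'e \<Rightarrow> 'w \<Rightarrow> 'f" where
  "lift_at P \<pi> e x = (THE h. h \<in> star P x \<and> emap \<pi> h = Inr e)"

definition transport ::
  "('w, 'f, 'n::finite) gkm_data \<Rightarrow> ('w, 'f, 'v, 'e) graph_map \<Rightarrow> 'e \<Rightarrow> 'w \<Rightarrow> 'w" where
  "transport P \<pi> e x = ter P (lift_at P \<pi> e x)"

definition fiber ::
  "('w, 'f, 'n::finite) gkm_data \<Rightarrow> ('w, 'f, 'v, 'e) graph_map \<Rightarrow> 'v \<Rightarrow> ('w, 'f, 'n) gkm_data" where
  "fiber P \<pi> q = P\<lparr>dgr := \<lparr>verts = {x \<in> Vs P. vmap \<pi> x = q},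
                           arcs = {\<epsilon> \<in> Es P. emap \<pi> \<epsilon> = Inl q},
                           tail = ini P, head = ter P\<rparr>\<rparr>"

definition fiber_lattice ::
  "('w, 'f, 'n::finite) gkm_data \<Rightarrow> ('w, 'f, 'v, 'e) graph_map \<Rightarrow> 'v \<Rightarrow> (int ^ 'n) set" where
  "fiber_lattice P \<pi> q = lattice.span (axial P ` Es (fiber P \<pi> q))"

text \<open>
  On vertices \<open>\<Phi>\<^sub>e\<close> is \<open>transport P \<pi> e\<close>. As fibers may have multiple edges, its action \<open>\<phi>\<close> on
  vertical edges is not determined by the action on vertices; it is the one given by the
  connection along the lifts of \<open>e\<close>.
\<close>

locale gkm_fiber_bundle = gkm_fibration P m' \<Gamma> m \<pi>
  for P :: "('w, 'f, 'n::finite) gkm_data" and m' :: nat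
    and \<Gamma> :: "('v, 'e, 'n) gkm_data" and m :: nat
    and \<pi> :: "('w, 'f, 'v, 'e) graph_map" +
  assumes transport_iso: "e \<in> Es \<Gamma> \<Longrightarrow>
    \<exists>\<phi> \<Psi>.
      graph_iso (fiber P \<pi> (ini \<Gamma> e)) (fiber P \<pi> (ter \<Gamma> e)) (transport P \<pi> e) \<phi> \<and>
      (\<forall>\<epsilon>\<in>Es (fiber P \<pi> (ini \<Gamma> e)). conn P (lift_at P \<pi> e (ini P \<epsilon>)) \<epsilon> = \<phi> \<epsilon>) \<and>
      lattice_iso \<Psi> (fiber_lattice P \<pi> (ini \<Gamma> e)) (fiber_lattice P \<pi> (ter \<Gamma> e)) \<and>
      gkm_iso \<Psi> (fiber P \<pi> (ini \<Gamma> e)) (fiber P \<pi> (ter \<Gamma> e)) (transport P \<pi> e) \<phi>"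


section \<open>Projective GKM fiber bundles\<close>

text \<open>
  The numbering \<open>\<nu>\<close> identifies the vertices of the fiber over \<open>p\<close> with \<open>{1..r+1}\<close>: the vertex
  \<open>(p, j)\<close> is the \<open>x\<close> over \<open>p\<close> with \<open>\<nu> x = j\<close>.
\<close>

definition fiber_edge ::
  "('w, 'f, 'n::finite) gkm_data \<Rightarrow> ('w, 'f, 'v, 'e) graph_map \<Rightarrow> ('w \<Rightarrow> nat) \<Rightarrow> 'v \<Rightarrow> nat \<Rightarrow> nat \<Rightarrow> 'f"
where
  "fiber_edge P \<pi> \<nu> p j k =
     (THE \<epsilon>. \<epsilon> \<in> Es (fiber P \<pi> p) \<and> \<nu> (ini P \<epsilon>) = j \<and> \<nu> (ter P \<epsilon>) = k)"

definition fiber_label ::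
  "('w, 'f, 'n::finite) gkm_data \<Rightarrow> ('w, 'f, 'v, 'e) graph_map \<Rightarrow> ('w \<Rightarrow> nat) \<Rightarrow> 'v \<Rightarrow> nat \<Rightarrow> nat \<Rightarrow> int ^ 'n"
where
  "fiber_label P \<pi> \<nu> p j k = (if j = k then 0 else axial P (fiber_edge P \<pi> \<nu> p j k))"

locale projective_gkm_fiber_bundle = gkm_fiber_bundle P m' \<Gamma> m \<pi>
  for P :: "('w, 'f, 'n::finite) gkm_data" and m' :: nat
    and \<Gamma> :: "('v, 'e, 'n) gkm_data" and m :: nat
    and \<pi> :: "('w, 'f, 'v, 'e) graph_map" +
  fixes r :: nat and \<nu> :: "'w \<Rightarrow> nat"
  assumes numbering: "p \<in> Vs \<Gamma> \<Longrightarrow> bij_betw \<nu> (Vs (fiber P \<pi> p)) {1..r+1}"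
    and no_vertical_loop: "\<lbrakk>p \<in> Vs \<Gamma>; \<epsilon> \<in> Es (fiber P \<pi> p)\<rbrakk> \<Longrightarrow> ini P \<epsilon> \<noteq> ter P \<epsilon>"
    and complete: "\<lbrakk>p \<in> Vs \<Gamma>; x \<in> Vs (fiber P \<pi> p); y \<in> Vs (fiber P \<pi> p); x \<noteq> y\<rbrakk> \<Longrightarrow>
      \<exists>!\<epsilon>. \<epsilon> \<in> Es (fiber P \<pi> p) \<and> ini P \<epsilon> = x \<and> ter P \<epsilon> = y"
    and standard_conn:
      "\<lbrakk>p \<in> Vs \<Gamma>; j \<in> {1..r+1}; k \<in> {1..r+1}; l \<in> {1..r+1}; j \<noteq> k; k \<noteq> l; j \<noteq> l\<rbrakk> \<Longrightarrow>
        conn P (fiber_edge P \<pi> \<nu> p j k) (fiber_edge P \<pi> \<nu> p j l) = fiber_edge P \<pi> \<nu> p k l"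
    and projective_labels:
      "\<lbrakk>p \<in> Vs \<Gamma>; j \<in> {1..r+1}; k \<in> {1..r+1}; l \<in> {1..r+1}\<rbrakk> \<Longrightarrow>
        fiber_label P \<pi> \<nu> p j k = fiber_label P \<pi> \<nu> p j l - fiber_label P \<pi> \<nu> p k l"

definition invariant_section ::
  "('w, 'f, 'n::finite) gkm_data \<Rightarrow> ('v, 'e, 'n::finite) gkm_data \<Rightarrow> ('w, 'f, 'v, 'e) graph_map \<Rightarrow>
   ('w, 'f) pre_digraph \<Rightarrow> bool" where
  "invariant_section P \<Gamma> \<pi> S \<longleftrightarrow>
     subgraph S (dgr P) \<and> (\<forall>\<epsilon>\<in>arcs S. rev_arc P \<epsilon> \<in> arcs S) \<and>
     bij_betw (vmap \<pi>) (verts S) (Vs \<Gamma>) \<and> bij_betw (emap \<pi>) (arcs S) (Inr ` Es \<Gamma>) \<and>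
     (\<forall>\<epsilon>\<in>arcs S. \<forall>\<epsilon>'\<in>out_arcs S (tail S \<epsilon>). conn P \<epsilon> \<epsilon>' \<in> arcs S)"


section \<open>Leg bundles and projectivization\<close>

record ('v, 'e, 'n) leg_data =
  weight :: "'v \<Rightarrow> nat \<Rightarrow> int ^ 'n"
  legmap :: "'e \<Rightarrow> nat \<Rightarrow> nat"

locale leg_bundle = gkm_graph \<Gamma> m
  for \<Gamma> :: "('v, 'e, 'n::finite) gkm_data" and m :: nat +
  fixes k :: nat and \<xi> :: "('v, 'e, 'n) leg_data"
  assumes legmap_bij: "e \<in> Es \<Gamma> \<Longrightarrow> bij_betw (legmap \<xi> e) {1..k} {1..k}"
    and legmap_rev: "\<lbrakk>e \<in> Es \<Gamma>; j \<in> {1..k}\<rbrakk> \<Longrightarrow> legmap \<xi> (rev_arc \<Gamma> e) (legmap \<xi> e j) = j"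
    and weight_cong: "\<lbrakk>e \<in> Es \<Gamma>; j \<in> {1..k}\<rbrakk> \<Longrightarrow>
      cong_mod (weight \<xi> (ter \<Gamma> e) (legmap \<xi> e j)) (weight \<xi> (ini \<Gamma> e) j) (axial \<Gamma> e)"

text \<open>\<open>Vert p j k\<close> is the edge \<open>(p, jk)\<close> and \<open>Hor e l\<close> is the edge \<open>(e, l)\<close>.\<close>

datatype ('v, 'e) proj_edge = Vert 'v nat nat | Hor 'e nat

fun proj_ini :: "('v, 'e, 'n::finite) gkm_data \<Rightarrow> ('v, 'e) proj_edge \<Rightarrow> 'v \<times> nat" where
  "proj_ini \<Gamma> (Vert p j k) = (p, j)"
| "proj_ini \<Gamma> (Hor e l) = (ini \<Gamma> e, l)"

fun proj_ter ::
  "('v, 'e, 'n::finite) gkm_data \<Rightarrow> ('v, 'e, 'n) leg_data \<Rightarrow> ('v, 'e) proj_edge \<Rightarrow> 'v \<times> nat" where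
  "proj_ter \<Gamma> \<xi> (Vert p j k) = (p, k)"
| "proj_ter \<Gamma> \<xi> (Hor e l) = (ter \<Gamma> e, legmap \<xi> e l)"

fun proj_rev ::
  "('v, 'e, 'n::finite) gkm_data \<Rightarrow> ('v, 'e, 'n) leg_data \<Rightarrow> ('v, 'e) proj_edge \<Rightarrow> ('v, 'e) proj_edge"
where
  "proj_rev \<Gamma> \<xi> (Vert p j k) = Vert p k j"
| "proj_rev \<Gamma> \<xi> (Hor e l) = Hor (rev_arc \<Gamma> e) (legmap \<xi> e l)"

fun proj_axial ::
  "('v, 'e, 'n::finite) gkm_data \<Rightarrow> ('v, 'e, 'n) leg_data \<Rightarrow> ('v, 'e) proj_edge \<Rightarrow> int ^ 'n" where
  "proj_axial \<Gamma> \<xi> (Vert p j k) = weight \<xi> p k - weight \<xi> p j"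
| "proj_axial \<Gamma> \<xi> (Hor e l) = axial \<Gamma> e"

text \<open>
  Only meaningful for two edges with the same initial vertex. For \<open>l = k\<close> the first equation
  is \<open>\<nabla>\<^sub>\<epsilon>(\<epsilon>)\<close>, the reversed edge; in the last equation the case \<open>e' = e\<close> gives it as well, since
  \<open>\<nabla>\<^sub>e(e)\<close> is the reverse of \<open>e\<close>.
\<close>

fun proj_conn ::
  "('v, 'e, 'n::finite) gkm_data \<Rightarrow> ('v, 'e, 'n) leg_data \<Rightarrow>
   ('v, 'e) proj_edge \<Rightarrow> ('v, 'e) proj_edge \<Rightarrow> ('v, 'e) proj_edge" where
  "proj_conn \<Gamma> \<xi> (Vert u j k) (Vert u' j' l) = (if l = k then Vert u k j else Vert u k l)"
| "proj_conn \<Gamma> \<xi> (Vert u j k) (Hor e j') = Hor e k"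
| "proj_conn \<Gamma> \<xi> (Hor e l) (Vert u l' k) = Vert (ter \<Gamma> e) (legmap \<xi> e l) (legmap \<xi> e k)"
| "proj_conn \<Gamma> \<xi> (Hor e l) (Hor e' l') = Hor (conn \<Gamma> e e') (legmap \<xi> e l)"

definition projectivization ::
  "('v, 'e, 'n::finite) gkm_data \<Rightarrow> nat \<Rightarrow> ('v, 'e, 'n) leg_data \<Rightarrow>
   ('v \<times> nat, ('v, 'e) proj_edge, 'n) gkm_data" where
  "projectivization \<Gamma> k \<xi> =
     \<lparr>dgr = \<lparr>verts = Vs \<Gamma> \<times> {1..k},
             arcs = {Vert p i j | p i j. p \<in> Vs \<Gamma> \<and> i \<in> {1..k} \<and> j \<in> {1..k} \<and> i \<noteq> j} \<union>
                    {Hor e l | e l. e \<in> Es \<Gamma> \<and> l \<in> {1..k}},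
             tail = proj_ini \<Gamma>, head = proj_ter \<Gamma> \<xi>\<rparr>,
      rev_arc = proj_rev \<Gamma> \<xi>,
      axial = proj_axial \<Gamma> \<xi>,
      conn = proj_conn \<Gamma> \<xi>\<rparr>"

fun proj_emap :: "('v, 'e) proj_edge \<Rightarrow> 'v + 'e" where
  "proj_emap (Vert p j k) = Inl p"
| "proj_emap (Hor e l) = Inr e"

definition proj_map :: "('v \<times> nat, ('v, 'e) proj_edge, 'v, 'e) graph_map" where
  "proj_map = \<lparr>vmap = fst, emap = proj_emap\<rparr>"

text \<open>
  The vertex map \<open>f\<close> and the edge map \<open>g\<close> identify \<open>P\<close> over \<open>\<pi>\<close> with \<open>P'\<close> over \<open>\<pi>'\<close>: labels and
  connection agree, and the identification lies over the identity of the base.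
\<close>

definition same_fibration ::
  "('w, 'f, 'n::finite) gkm_data \<Rightarrow> ('w, 'f, 'v, 'e) graph_map \<Rightarrow>
   ('x, 'g, 'n::finite) gkm_data \<Rightarrow> ('x, 'g, 'v, 'e) graph_map \<Rightarrow> ('w \<Rightarrow> 'x) \<Rightarrow> ('f \<Rightarrow> 'g) \<Rightarrow> bool" where
  "same_fibration P \<pi> P' \<pi>' f g \<longleftrightarrow> gkm_iso id P P' f g \<and>
     (\<forall>x\<in>Vs P. vmap \<pi>' (f x) = vmap \<pi> x) \<and> (\<forall>\<epsilon>\<in>Es P. emap \<pi>' (g \<epsilon>) = emap \<pi> \<epsilon>)"

end

theory Submission
  imports Defs
begin

text \<open>
  A leg bundle is recovered from its projectivization up to a common shift of the weights in each
  fiber: only the differences \<open>\<xi>\<^sub>p\<^sup>k - \<xi>\<^sub>p\<^sup>j\<close> appear as labels. The projective relation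
  on the labels says that the labels of each single fiber are such differences, so the only obstacle
  is to fix the shift over all base vertices consistently. A section does this: with base point
  \<open>s p\<close> in the fiber over \<open>p\<close>, normalize the weights by \<open>\<xi>\<^sub>p\<^bsup>s p\<^esup> = 0\<close>, which forces
  \<open>\<xi>\<^sub>p\<^sup>j\<close> to be the label of the vertical edge from \<open>s p\<close> to \<open>j\<close>; and let \<open>\<sigma>\<^sub>e\<close> be the
  transport \<open>\<Phi>\<^sub>e\<close> read in the numbering of the fibers.

  The congruence of the weights along \<open>e\<close> is the place where the section matters. The lift of \<open>e\<close>
  at \<open>s (i(e))\<close> lies in the section, hence ends at \<open>s (t(e))\<close>. The connection along this lift acts on
  vertical edges as \<open>\<Phi>\<^sub>e\<close> does, so it carries the edge from \<open>s (i(e))\<close> to \<open>j\<close> to the edge from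
  \<open>s (t(e))\<close> to \<open>\<sigma>\<^sub>e(j)\<close>: the two weights are the labels of an edge and of its image under the
  connection, and these are congruent modulo \<open>\<alpha>(e)\<close> (lemma \<open>section_legs_bundle\<close>).

  The identification with the projectivization is then a matter of naming the edges. In
  \<open>\<Pi>\<close>, a vertical edge is determined by its end points since the fibers are complete graphs, and a horizontal edge by its
  projection and its initial vertex since \<open>\<pi>\<close> is a fibration; these are the data that name the
  edges of \<open>\<Pi>(\<xi>)\<close>. The conditions on a projective bundle determine the connection of \<open>\<Pi>\<close> in
  each of the four combinations of vertical and horizontal edges, with the values that define the
  connection of \<open>\<Pi>(\<xi>)\<close> (lemmas \<open>edge_name_conn\<close> and \<open>section_legs_projectivization\<close>).
\<close>

section \<open>Vertical and horizontal edges\<close>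

context gkm_fibration
begin

lemma vmap_in: "x \<in> Vs P \<Longrightarrow> vmap \<pi> x \<in> Vs \<Gamma>"
  using fibration unfolding graph_fibration_def graph_morphism_def by blast

lemma edge_cases:
  assumes "\<epsilon> \<in> Es P"
  obtains (vertical) "emap \<pi> \<epsilon> = Inl (vmap \<pi> (ini P \<epsilon>))" "vmap \<pi> (ter P \<epsilon>) = vmap \<pi> (ini P \<epsilon>)"
  | (horizontal) e where "e \<in> Es \<Gamma>" "emap \<pi> \<epsilon> = Inr e" "vmap \<pi> (ini P \<epsilon>) = ini \<Gamma> e"
  using assms fibration unfolding graph_fibration_def graph_morphism_def by blast

lemma emap_rev: "\<epsilon> \<in> Es P \<Longrightarrow> emap \<pi> (rev_arc P \<epsilon>) = map_sum id (rev_arc \<Gamma>) (emap \<pi> \<epsilon>)"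
  using fibration unfolding graph_fibration_def graph_morphism_def by blast

lemma vertical_ends:
  assumes "\<epsilon> \<in> Es P" "emap \<pi> \<epsilon> = Inl q"
  shows "vmap \<pi> (ini P \<epsilon>) = q" "vmap \<pi> (ter P \<epsilon>) = q" "q \<in> Vs \<Gamma>"
proof -
  show v: "vmap \<pi> (ini P \<epsilon>) = q" "vmap \<pi> (ter P \<epsilon>) = q"
    using assms by (auto elim: edge_cases)
  show "q \<in> Vs \<Gamma>"
    using v(1) vmap_in total.tail_in_verts assms(1) by blast
qed

lemma horizontal_ini:
  assumes "\<epsilon> \<in> Es P" "emap \<pi> \<epsilon> = Inr e"
  shows "e \<in> Es \<Gamma>" "vmap \<pi> (ini P \<epsilon>) = ini \<Gamma> e"
  using assms by (auto elim: edge_cases)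

text \<open>
  A graph morphism is constrained at initial vertices only; compatibility with edge reversal gives
  the terminal ones.
\<close>

lemma horizontal_ter:
  assumes "\<epsilon> \<in> Es P" "emap \<pi> \<epsilon> = Inr e"
  shows "vmap \<pi> (ter P \<epsilon>) = ter \<Gamma> e"
proof -
  have "e \<in> Es \<Gamma>" using assms horizontal_ini by blast
  moreover have "emap \<pi> (rev_arc P \<epsilon>) = Inr (rev_arc \<Gamma> e)"
    using assms by (simp add: emap_rev)
  ultimately show ?thesis
    using horizontal_ini(2)[of "rev_arc P \<epsilon>"] assms total.rev_in total.ini_rev base.ini_rev by metis
qed

lemma lift_ex1:
  assumes "x \<in> Vs P" "e \<in> star \<Gamma> (vmap \<pi> x)"
  shows "\<exists>!h. h \<in> star P x \<and> emap \<pi> h = Inr e"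
proof -
  have b: "bij_betw (emap \<pi>) (horizontal_star P \<pi> x) (Inr ` star \<Gamma> (vmap \<pi> x))"
    using fibration assms(1) unfolding graph_fibration_def by blast
  then have "Inr e \<in> emap \<pi> ` horizontal_star P \<pi> x"
    using assms(2) by (simp add: bij_betw_def)
  moreover have "h = h'"
    if "h \<in> star P x" "emap \<pi> h = Inr e" "h' \<in> star P x" "emap \<pi> h' = Inr e" for h h'
    by (rule inj_onD[OF bij_betw_imp_inj_on[OF b]])
      (use that in \<open>auto simp: horizontal_star_def horizontal_def\<close>)
  ultimately show ?thesis
    by (auto simp: horizontal_star_def)
qed

lemma lift_at_eqI:
  assumes "h \<in> Es P" "emap \<pi> h = Inr e"
  shows "lift_at P \<pi> e (ini P h) = h"
proof -
  have "e \<in> star \<Gamma> (vmap \<pi> (ini P h))"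
    using horizontal_ini[OF assms] by simp
  then have "\<exists>!h'. h' \<in> star P (ini P h) \<and> emap \<pi> h' = Inr e"
    using assms(1) lift_ex1 by simp
  then show ?thesis
    unfolding lift_at_def using assms by (intro the1_equality) auto
qed

lemma transport_eqI:
  "\<lbrakk>h \<in> Es P; emap \<pi> h = Inr e\<rbrakk> \<Longrightarrow> transport P \<pi> e (ini P h) = ter P h"
  by (simp add: transport_def lift_at_eqI)

lemma lift_at:
  assumes "x \<in> Vs P" "e \<in> Es \<Gamma>" "vmap \<pi> x = ini \<Gamma> e"
  shows "lift_at P \<pi> e x \<in> Es P" "ini P (lift_at P \<pi> e x) = x"
    "emap \<pi> (lift_at P \<pi> e x) = Inr e"
proof -
  have "\<exists>!h. h \<in> star P x \<and> emap \<pi> h = Inr e"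
    using assms by (intro lift_ex1) auto
  then have "lift_at P \<pi> e x \<in> star P x \<and> emap \<pi> (lift_at P \<pi> e x) = Inr e"
    unfolding lift_at_def by (rule theI')
  then show "lift_at P \<pi> e x \<in> Es P" "ini P (lift_at P \<pi> e x) = x"
    "emap \<pi> (lift_at P \<pi> e x) = Inr e" by auto
qed

lemma transport_rev:
  assumes "x \<in> Vs P" "e \<in> Es \<Gamma>" "vmap \<pi> x = ini \<Gamma> e"
  shows "transport P \<pi> (rev_arc \<Gamma> e) (transport P \<pi> e x) = x"
proof -
  let ?h = "lift_at P \<pi> e x"
  note h = lift_at[OF assms]
  have "transport P \<pi> (rev_arc \<Gamma> e) (ini P (rev_arc P ?h)) = ter P (rev_arc P ?h)"
    using h by (intro transport_eqI) (simp_all add: total.rev_in emap_rev)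
  then show ?thesis
    using h by (simp add: transport_def total.ini_rev total.ter_rev)
qed

lemma conn_in_star:
  assumes "\<epsilon> \<in> Es P" "\<epsilon>' \<in> Es P" "ini P \<epsilon>' = ini P \<epsilon>"
  shows "conn P \<epsilon> \<epsilon>' \<in> Es P" "ini P (conn P \<epsilon> \<epsilon>') = ter P \<epsilon>"
  using bij_betwE[OF total.conn_bij[OF assms(1)]] assms(2,3) by auto

lemma fiber_simps:
  "Vs (fiber P \<pi> q) = {x \<in> Vs P. vmap \<pi> x = q}"
  "Es (fiber P \<pi> q) = {\<epsilon> \<in> Es P. emap \<pi> \<epsilon> = Inl q}"
  "ini (fiber P \<pi> q) = ini P" "ter (fiber P \<pi> q) = ter P"
  by (simp_all add: fiber_def)

end

context gkm_fiber_bundle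
begin

lemma transport_bij:
  assumes "e \<in> Es \<Gamma>"
  shows "bij_betw (transport P \<pi> e) (Vs (fiber P \<pi> (ini \<Gamma> e))) (Vs (fiber P \<pi> (ter \<Gamma> e)))"
  using transport_iso[OF assms] unfolding graph_iso_def by blast

lemma conn_horizontal_vertical:
  assumes "h \<in> Es P" "emap \<pi> h = Inr e" "\<epsilon> \<in> Es P" "emap \<pi> \<epsilon> = Inl q" "ini P \<epsilon> = ini P h"
  shows "emap \<pi> (conn P h \<epsilon>) = Inl (ter \<Gamma> e)"
    and "ter P (conn P h \<epsilon>) = transport P \<pi> e (ter P \<epsilon>)"
proof -
  have e: "e \<in> Es \<Gamma>" "q = ini \<Gamma> e"
    using assms horizontal_ini vertical_ends(1) by metis+
  obtain \<phi> where \<phi>: "graph_iso (fiber P \<pi> (ini \<Gamma> e)) (fiber P \<pi> (ter \<Gamma> e)) (transport P \<pi> e) \<phi>"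
    "\<forall>\<epsilon>\<in>Es (fiber P \<pi> (ini \<Gamma> e)). conn P (lift_at P \<pi> e (ini P \<epsilon>)) \<epsilon> = \<phi> \<epsilon>"
    using transport_iso[OF e(1)] by blast
  have \<epsilon>: "\<epsilon> \<in> Es (fiber P \<pi> (ini \<Gamma> e))"
    using assms e by (simp add: fiber_simps)
  then have c: "conn P h \<epsilon> = \<phi> \<epsilon>"
    using \<phi>(2) assms lift_at_eqI by force
  have "\<phi> \<epsilon> \<in> Es (fiber P \<pi> (ter \<Gamma> e))"
    using \<phi>(1) \<epsilon> unfolding graph_iso_def by (blast dest: bij_betwE)
  then show "emap \<pi> (conn P h \<epsilon>) = Inl (ter \<Gamma> e)"
    using c by (simp add: fiber_simps)
  show "ter P (conn P h \<epsilon>) = transport P \<pi> e (ter P \<epsilon>)"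
    using \<phi>(1) \<epsilon> c unfolding graph_iso_def fiber_simps by auto
qed

end


section \<open>The leg bundle of a section\<close>

context projective_gkm_fiber_bundle
begin

definition vertex_at :: "'v \<Rightarrow> nat \<Rightarrow> 'w" where
  "vertex_at p = inv_into (Vs (fiber P \<pi> p)) \<nu>"

lemma vertex_at:
  assumes "p \<in> Vs \<Gamma>" "j \<in> {1..r+1}"
  shows "vertex_at p j \<in> Vs P" "vmap \<pi> (vertex_at p j) = p" "\<nu> (vertex_at p j) = j"
proof -
  have j: "j \<in> \<nu> ` Vs (fiber P \<pi> p)"
    using numbering[OF assms(1)] assms(2) by (simp add: bij_betw_def)
  show "\<nu> (vertex_at p j) = j"
    unfolding vertex_at_def using j by (rule f_inv_into_f)
  show "vertex_at p j \<in> Vs P" "vmap \<pi> (vertex_at p j) = p"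
    using inv_into_into[OF j] by (simp_all add: vertex_at_def fiber_simps)
qed

lemma \<nu>_in: "x \<in> Vs P \<Longrightarrow> \<nu> x \<in> {1..r+1}"
  using bij_betwE[OF numbering[OF vmap_in]] by (auto simp: fiber_simps)

lemma \<nu>_eqD: "\<lbrakk>x \<in> Vs P; y \<in> Vs P; vmap \<pi> x = vmap \<pi> y; \<nu> x = \<nu> y\<rbrakk> \<Longrightarrow> x = y"
  using bij_betw_imp_inj_on[OF numbering[OF vmap_in, of y]]
  by (auto simp: fiber_simps dest: inj_onD)

lemma vertex_at_\<nu>: "x \<in> Vs P \<Longrightarrow> vertex_at (vmap \<pi> x) (\<nu> x) = x"
  using vertex_at[OF vmap_in \<nu>_in] by (intro \<nu>_eqD) auto

lemma vertical_not_loop: "\<lbrakk>\<epsilon> \<in> Es P; emap \<pi> \<epsilon> = Inl p\<rbrakk> \<Longrightarrow> ini P \<epsilon> \<noteq> ter P \<epsilon>"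
  using no_vertical_loop[of p] vertical_ends(3) by (simp add: fiber_simps)

lemma vertical_unique:
  assumes "\<epsilon> \<in> Es P" "emap \<pi> \<epsilon> = Inl p" "\<epsilon>' \<in> Es P" "emap \<pi> \<epsilon>' = Inl p"
    and "\<nu> (ini P \<epsilon>') = \<nu> (ini P \<epsilon>)" "\<nu> (ter P \<epsilon>') = \<nu> (ter P \<epsilon>)"
  shows "\<epsilon>' = \<epsilon>"
proof -
  note v = vertical_ends[OF assms(1,2)] vertical_ends[OF assms(3,4)]
  have "ini P \<epsilon>' = ini P \<epsilon>" "ter P \<epsilon>' = ter P \<epsilon>"
    using assms v by (auto intro!: \<nu>_eqD)
  moreover have "ini P \<epsilon> \<noteq> ter P \<epsilon>"
    using vertical_not_loop assms(1,2) by blast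
  ultimately show ?thesis
    using complete[of p "ini P \<epsilon>" "ter P \<epsilon>"] assms(1-4) v by (auto simp: fiber_simps)
qed

lemma fiber_edge_eqI:
  assumes "\<epsilon> \<in> Es P" "emap \<pi> \<epsilon> = Inl p"
  shows "fiber_edge P \<pi> \<nu> p (\<nu> (ini P \<epsilon>)) (\<nu> (ter P \<epsilon>)) = \<epsilon>"
  unfolding fiber_edge_def
  by (rule the_equality) (use assms vertical_unique in \<open>auto simp: fiber_simps\<close>)

lemma fiber_edge:
  assumes "p \<in> Vs \<Gamma>" "j \<in> {1..r+1}" "k \<in> {1..r+1}" "j \<noteq> k"
  shows "fiber_edge P \<pi> \<nu> p j k \<in> Es P" "emap \<pi> (fiber_edge P \<pi> \<nu> p j k) = Inl p"
    "ini P (fiber_edge P \<pi> \<nu> p j k) = vertex_at p j"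
    "ter P (fiber_edge P \<pi> \<nu> p j k) = vertex_at p k"
proof -
  have "vertex_at p j \<noteq> vertex_at p k"
    using vertex_at(3) assms by metis
  then obtain \<epsilon> where \<epsilon>: "\<epsilon> \<in> Es (fiber P \<pi> p)" "ini P \<epsilon> = vertex_at p j" "ter P \<epsilon> = vertex_at p k"
    using complete[of p "vertex_at p j" "vertex_at p k"] assms vertex_at by (auto simp: fiber_simps)
  then have "fiber_edge P \<pi> \<nu> p j k = \<epsilon>"
    using fiber_edge_eqI[of \<epsilon> p] vertex_at(3) assms by (simp add: fiber_simps)
  with \<epsilon> show "fiber_edge P \<pi> \<nu> p j k \<in> Es P" "emap \<pi> (fiber_edge P \<pi> \<nu> p j k) = Inl p"
    "ini P (fiber_edge P \<pi> \<nu> p j k) = vertex_at p j"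
    "ter P (fiber_edge P \<pi> \<nu> p j k) = vertex_at p k" by (auto simp: fiber_simps)
qed

lemma fiber_label_vertical:
  assumes "\<epsilon> \<in> Es P" "emap \<pi> \<epsilon> = Inl p"
  shows "fiber_label P \<pi> \<nu> p (\<nu> (ini P \<epsilon>)) (\<nu> (ter P \<epsilon>)) = axial P \<epsilon>"
proof -
  have "\<nu> (ini P \<epsilon>) \<noteq> \<nu> (ter P \<epsilon>)"
    using vertical_not_loop[OF assms] vertical_ends[OF assms] \<nu>_eqD assms(1) by auto
  then show ?thesis
    by (simp add: fiber_label_def fiber_edge_eqI[OF assms])
qed

text \<open>
  The projective relation compares edges that end at a common vertex. Solved for its last term, it
  compares edges that issue from a common vertex \<open>i\<close>, which is the form of the labels of a
  projectivization, with the labels at \<open>i\<close> as weights.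
\<close>

lemma fiber_label_diff:
  assumes "p \<in> Vs \<Gamma>" "i \<in> {1..r+1}" "j \<in> {1..r+1}" "k \<in> {1..r+1}"
  shows "fiber_label P \<pi> \<nu> p j k = fiber_label P \<pi> \<nu> p i k - fiber_label P \<pi> \<nu> p i j"
proof -
  have "fiber_label P \<pi> \<nu> p i j = fiber_label P \<pi> \<nu> p i k - fiber_label P \<pi> \<nu> p j k"
    using assms projective_labels by blast
  then show ?thesis by simp
qed

definition section_legs :: "('v \<Rightarrow> 'w) \<Rightarrow> ('v, 'e, 'n) leg_data" where
  "section_legs s =
     \<lparr>weight = \<lambda>p. fiber_label P \<pi> \<nu> p (\<nu> (s p)),
      legmap = \<lambda>e j. \<nu> (transport P \<pi> e (vertex_at (ini \<Gamma> e) j))\<rparr>"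

lemma legmap_\<nu>:
  "\<lbrakk>x \<in> Vs P; vmap \<pi> x = ini \<Gamma> e\<rbrakk> \<Longrightarrow> legmap (section_legs s) e (\<nu> x) = \<nu> (transport P \<pi> e x)"
  using vertex_at_\<nu>[of x] by (simp add: section_legs_def)

lemma legmap_horizontal:
  assumes "h \<in> Es P" "emap \<pi> h = Inr e"
  shows "legmap (section_legs s) e (\<nu> (ini P h)) = \<nu> (ter P h)"
  using legmap_\<nu>[of "ini P h"] horizontal_ini[OF assms] transport_eqI[OF assms] assms(1) by simp

lemma legmap_section_legs_bij:
  assumes "e \<in> Es \<Gamma>"
  shows "bij_betw (legmap (section_legs s) e) {1..r+1} {1..r+1}"
proof -
  have p: "ini \<Gamma> e \<in> Vs \<Gamma>" "ter \<Gamma> e \<in> Vs \<Gamma>"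
    using assms by simp_all
  have "legmap (section_legs s) e = \<nu> \<circ> (transport P \<pi> e \<circ> vertex_at (ini \<Gamma> e))"
    by (auto simp: section_legs_def)
  then show ?thesis
    unfolding vertex_at_def
    using bij_betw_trans[OF bij_betw_trans[OF bij_betw_inv_into[OF numbering[OF p(1)]]
          transport_bij[OF assms]] numbering[OF p(2)]]
    by simp
qed

text \<open>
  The weights at \<open>s\<close> itself are \<open>0\<close>, the value of \<open>fiber_label\<close> on the diagonal, and the
  transports preserve \<open>s\<close>, so the congruence is trivial there. At the other vertices it is the
  congruence satisfied by the connection along the lift of \<open>e\<close> at \<open>s (i(e))\<close>.
\<close>

lemma section_legs_bundle:
  assumes s: "\<And>p. p \<in> Vs \<Gamma> \<Longrightarrow> s p \<in> Vs P \<and> vmap \<pi> (s p) = p"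
    and parallel: "\<And>e. e \<in> Es \<Gamma> \<Longrightarrow> transport P \<pi> e (s (ini \<Gamma> e)) = s (ter \<Gamma> e)"
  shows "leg_bundle \<Gamma> m (r + 1) (section_legs s)"
proof
  fix e assume e: "e \<in> Es \<Gamma>"
  then have p: "ini \<Gamma> e \<in> Vs \<Gamma>" and q: "ter \<Gamma> e \<in> Vs \<Gamma>"
    by simp_all
  show "bij_betw (legmap (section_legs s) e) {1..r + 1} {1..r + 1}"
    using e by (rule legmap_section_legs_bij)
  fix j assume j: "j \<in> {1..r + 1}"
  define x where "x = vertex_at (ini \<Gamma> e) j"
  have x: "x \<in> Vs P" "vmap \<pi> x = ini \<Gamma> e" "\<nu> x = j"
    using vertex_at[OF p j] by (simp_all add: x_def)
  define y where "y = transport P \<pi> e x"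
  have y: "y \<in> Vs P" "vmap \<pi> y = ter \<Gamma> e"
    using bij_betwE[OF transport_bij[OF e]] x by (auto simp: y_def fiber_simps)
  have \<sigma>: "legmap (section_legs s) e j = \<nu> y"
    using legmap_\<nu>[OF x(1,2)] x(3) by (simp add: y_def)
  have "legmap (section_legs s) (rev_arc \<Gamma> e) (\<nu> y) = \<nu> x"
    using legmap_\<nu>[OF y(1), of "rev_arc \<Gamma> e"] y(2) transport_rev[OF x(1) e x(2)] e
    by (simp add: base.ini_rev y_def)
  then show "legmap (section_legs s) (rev_arc \<Gamma> e) (legmap (section_legs s) e j) = j"
    using \<sigma> x(3) by simp
  show "cong_mod (weight (section_legs s) (ter \<Gamma> e) (legmap (section_legs s) e j))
          (weight (section_legs s) (ini \<Gamma> e) j) (axial \<Gamma> e)"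
  proof (cases "x = s (ini \<Gamma> e)")
    case True
    then have "y = s (ter \<Gamma> e)"
      using parallel[OF e] by (simp add: y_def)
    then have "weight (section_legs s) (ter \<Gamma> e) (legmap (section_legs s) e j) = 0"
      by (simp only: \<sigma>) (simp add: section_legs_def fiber_label_def)
    moreover have "weight (section_legs s) (ini \<Gamma> e) j = 0"
      using True x(3) by (auto simp: section_legs_def fiber_label_def)
    ultimately show ?thesis
      by (auto simp: cong_mod_def intro: exI[of _ 0])
  next
    case False
    define h where "h = lift_at P \<pi> e (s (ini \<Gamma> e))"
    have h: "h \<in> Es P" "ini P h = s (ini \<Gamma> e)" "emap \<pi> h = Inr e"
      using lift_at s[OF p] e by (auto simp: h_def)
    have ter_h: "ter P h = s (ter \<Gamma> e)"
      using transport_eqI[OF h(1,3)] h(2) parallel[OF e] by simp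
    obtain \<epsilon> where \<epsilon>: "\<epsilon> \<in> Es P" "emap \<pi> \<epsilon> = Inl (ini \<Gamma> e)" "ini P \<epsilon> = s (ini \<Gamma> e)" "ter P \<epsilon> = x"
      using complete[OF p, of "s (ini \<Gamma> e)" x] s[OF p] x False by (auto simp: fiber_simps)
    let ?\<epsilon>' = "conn P h \<epsilon>"
    have \<epsilon>': "?\<epsilon>' \<in> Es P" "ini P ?\<epsilon>' = s (ter \<Gamma> e)"
      using conn_in_star[of h \<epsilon>] h \<epsilon> ter_h by auto
    have "emap \<pi> ?\<epsilon>' = Inl (ter \<Gamma> e)" "ter P ?\<epsilon>' = y"
      using conn_horizontal_vertical[OF h(1,3) \<epsilon>(1,2)] h \<epsilon> by (simp_all add: y_def)
    then have "weight (section_legs s) (ter \<Gamma> e) (\<nu> y) = axial P ?\<epsilon>'"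
      using fiber_label_vertical[of ?\<epsilon>'] \<epsilon>' by (simp add: section_legs_def)
    moreover have "weight (section_legs s) (ini \<Gamma> e) j = axial P \<epsilon>"
      using fiber_label_vertical[OF \<epsilon>(1,2)] \<epsilon>(3,4) x(3) by (simp add: section_legs_def)
    moreover have "axial P h = axial \<Gamma> e"
      using axial_lift h by blast
    ultimately show ?thesis
      using total.conn_cong[OF h(1), of \<epsilon>] \<epsilon> h \<sigma> by simp
  qed
qed


section \<open>Identification with the projectivization\<close>

definition edge_name :: "'f \<Rightarrow> ('v, 'e) proj_edge" where
  "edge_name \<epsilon> = (case emap \<pi> \<epsilon> of
     Inl p \<Rightarrow> Vert p (\<nu> (ini P \<epsilon>)) (\<nu> (ter P \<epsilon>))
   | Inr e \<Rightarrow> Hor e (\<nu> (ini P \<epsilon>)))"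

lemma edge_name_simps:
  "emap \<pi> \<epsilon> = Inl p \<Longrightarrow> edge_name \<epsilon> = Vert p (\<nu> (ini P \<epsilon>)) (\<nu> (ter P \<epsilon>))"
  "emap \<pi> \<epsilon> = Inr e \<Longrightarrow> edge_name \<epsilon> = Hor e (\<nu> (ini P \<epsilon>))"
  by (simp_all add: edge_name_def)

lemma vertex_name_bij:
  "bij_betw (\<lambda>x. (vmap \<pi> x, \<nu> x)) (Vs P) (Vs \<Gamma> \<times> {1..r+1})"
  by (rule bij_betw_byWitness[where f' = "\<lambda>(p, j). vertex_at p j"])
    (use vmap_in \<nu>_in vertex_at vertex_at_\<nu> in auto)

lemma edge_name_inj: "inj_on edge_name (Es P)"
proof (rule inj_onI)
  fix \<epsilon> \<epsilon>' assume *: "\<epsilon> \<in> Es P" "\<epsilon>' \<in> Es P" "edge_name \<epsilon> = edge_name \<epsilon>'"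
  show "\<epsilon> = \<epsilon>'"
  proof (cases "emap \<pi> \<epsilon>")
    case (Inl p)
    then have "emap \<pi> \<epsilon>' = Inl p"
      "\<nu> (ini P \<epsilon>') = \<nu> (ini P \<epsilon>)" "\<nu> (ter P \<epsilon>') = \<nu> (ter P \<epsilon>)"
      using *(3) by (auto simp: edge_name_def split: sum.splits)
    then show ?thesis
      using * Inl vertical_unique by metis
  next
    case (Inr e)
    then have e': "emap \<pi> \<epsilon>' = Inr e" "\<nu> (ini P \<epsilon>') = \<nu> (ini P \<epsilon>)"
      using *(3) by (auto simp: edge_name_def split: sum.splits)
    then have "ini P \<epsilon>' = ini P \<epsilon>"
      using horizontal_ini(2) Inr * by (intro \<nu>_eqD) auto
    then show ?thesis
      using lift_at_eqI Inr e' * by metis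
  qed
qed

lemma edge_name_image:
  "edge_name ` Es P = Es (projectivization \<Gamma> (r + 1) \<xi>)"
proof
  show "edge_name ` Es P \<subseteq> Es (projectivization \<Gamma> (r + 1) \<xi>)"
  proof
    fix a assume "a \<in> edge_name ` Es P"
    then obtain \<epsilon> where \<epsilon>: "\<epsilon> \<in> Es P" "a = edge_name \<epsilon>" by blast
    have n: "\<nu> (ini P \<epsilon>) \<in> {1..r+1}" "\<nu> (ter P \<epsilon>) \<in> {1..r+1}"
      using \<epsilon>(1) \<nu>_in by simp_all
    show "a \<in> Es (projectivization \<Gamma> (r + 1) \<xi>)"
    proof (cases "emap \<pi> \<epsilon>")
      case (Inl p)
      note v = vertical_ends[OF \<epsilon>(1) Inl]
      have "\<nu> (ini P \<epsilon>) \<noteq> \<nu> (ter P \<epsilon>)"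
        using \<nu>_eqD v vertical_not_loop[OF \<epsilon>(1) Inl] \<epsilon>(1) by auto
      then show ?thesis
        using \<epsilon>(2) n v(3) edge_name_simps(1)[OF Inl] by (auto simp: projectivization_def)
    next
      case (Inr e)
      then show ?thesis
        using \<epsilon> n edge_name_simps(2)[OF Inr] horizontal_ini(1) by (auto simp: projectivization_def)
    qed
  qed
  show "Es (projectivization \<Gamma> (r + 1) \<xi>) \<subseteq> edge_name ` Es P"
  proof
    fix a assume "a \<in> Es (projectivization \<Gamma> (r + 1) \<xi>)"
    then consider
      (vert) p i j where "a = Vert p i j" "p \<in> Vs \<Gamma>" "i \<in> {1..r+1}" "j \<in> {1..r+1}" "i \<noteq> j"
    | (hor) e l where "a = Hor e l" "e \<in> Es \<Gamma>" "l \<in> {1..r+1}"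
      by (auto simp: projectivization_def)
    then show "a \<in> edge_name ` Es P"
    proof cases
      case vert
      note f = fiber_edge[OF vert(2-5)]
      have "edge_name (fiber_edge P \<pi> \<nu> p i j) = a"
        using edge_name_simps(1)[OF f(2)] f(3,4) vertex_at(3) vert by simp
      then show ?thesis using f(1) by blast
    next
      case hor
      have "ini \<Gamma> e \<in> Vs \<Gamma>" using hor(2) by simp
      note v = vertex_at[OF this hor(3)]
      note h = lift_at[OF v(1) hor(2) v(2)]
      have "edge_name (lift_at P \<pi> e (vertex_at (ini \<Gamma> e) l)) = a"
        using edge_name_simps(2)[OF h(3)] h(2) v(3) hor(1) by simp
      then show ?thesis using h(1) by blast
    qed
  qed
qed

lemma edge_name_rev:
  assumes "\<epsilon> \<in> Es P"
  shows "edge_name (rev_arc P \<epsilon>) = proj_rev \<Gamma> (section_legs s) (edge_name \<epsilon>)"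
proof (cases "emap \<pi> \<epsilon>")
  case (Inl p)
  then show ?thesis
    using assms by (simp add: edge_name_def emap_rev total.ini_rev total.ter_rev)
next
  case (Inr e)
  then show ?thesis
    using assms legmap_horizontal[OF assms Inr] by (simp add: edge_name_def emap_rev total.ini_rev)
qed

lemma edge_name_axial:
  assumes "\<And>p. p \<in> Vs \<Gamma> \<Longrightarrow> s p \<in> Vs P" "\<epsilon> \<in> Es P"
  shows "proj_axial \<Gamma> (section_legs s) (edge_name \<epsilon>) = axial P \<epsilon>"
proof (cases "emap \<pi> \<epsilon>")
  case (Inl p)
  note p = vertical_ends(3)[OF assms(2) Inl]
  have "fiber_label P \<pi> \<nu> p (\<nu> (ini P \<epsilon>)) (\<nu> (ter P \<epsilon>)) =
      fiber_label P \<pi> \<nu> p (\<nu> (s p)) (\<nu> (ter P \<epsilon>)) - fiber_label P \<pi> \<nu> p (\<nu> (s p)) (\<nu> (ini P \<epsilon>))"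
    by (rule fiber_label_diff) (use p assms \<nu>_in in simp_all)
  then show ?thesis
    using fiber_label_vertical[OF assms(2) Inl]
    by (simp add: edge_name_simps(1)[OF Inl] section_legs_def)
next
  case (Inr e)
  then show ?thesis
    using axial_lift[OF assms(2) Inr] by (simp add: edge_name_simps(2)[OF Inr])
qed

text \<open>
  The connection is prescribed in each of the four cases. Two vertical edges are governed by the
  standard connection of the complete graph, or by \<open>\<nabla>\<^sub>\<epsilon>(\<epsilon>)\<close> being the reversed edge if
  they coincide. Along a vertical edge, a horizontal one keeps its projection. Along a lift of \<open>e\<close>, a
  vertical edge is moved by \<open>\<Phi>\<^sub>e\<close>, and a horizontal one as \<open>\<nabla>\<^sub>e\<close> moves its projection.
\<close>

lemma edge_name_conn:
  assumes \<epsilon>: "\<epsilon> \<in> Es P" and \<epsilon>': "\<epsilon>' \<in> Es P" "ini P \<epsilon>' = ini P \<epsilon>"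
  shows "edge_name (conn P \<epsilon> \<epsilon>') = proj_conn \<Gamma> (section_legs s) (edge_name \<epsilon>) (edge_name \<epsilon>')"
proof -
  note c = conn_in_star[OF assms]
  have star: "\<epsilon>' \<in> star P (ini P \<epsilon>)"
    using \<epsilon>' by simp
  show ?thesis
  proof (cases "emap \<pi> \<epsilon>")
    case v: (Inl p)
    note ends = vertical_ends[OF \<epsilon> v]
    show ?thesis
    proof (cases "emap \<pi> \<epsilon>'")
      case (Inl p')
      then have v': "emap \<pi> \<epsilon>' = Inl p"
        using vertical_ends(1)[OF \<epsilon>'(1)] \<epsilon>'(2) ends by simp
      note ends' = vertical_ends[OF \<epsilon>'(1) v']
      show ?thesis
      proof (cases "\<nu> (ter P \<epsilon>') = \<nu> (ter P \<epsilon>)")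
        case True
        then have "\<epsilon>' = \<epsilon>"
          using vertical_unique[OF \<epsilon> v \<epsilon>'(1) v'] \<epsilon>'(2) by simp
        then show ?thesis
          using total.conn_self[OF \<epsilon>] edge_name_rev[OF \<epsilon>, of s]
          by (simp add: edge_name_simps(1)[OF v])
      next
        case False
        define j k l where jkl: "j = \<nu> (ini P \<epsilon>)" "k = \<nu> (ter P \<epsilon>)" "l = \<nu> (ter P \<epsilon>')"
        note p = ends(3)
        have in_range: "j \<in> {1..r+1}" "k \<in> {1..r+1}" "l \<in> {1..r+1}"
          unfolding jkl using \<nu>_in \<epsilon> \<epsilon>' by simp_all
        have "j \<noteq> k" "j \<noteq> l"
          using vertical_not_loop[OF \<epsilon> v] vertical_not_loop[OF \<epsilon>'(1) v'] ends ends' \<epsilon> \<epsilon>' \<nu>_eqD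
          unfolding jkl by auto
        moreover have "k \<noteq> l"
          using False by (simp add: jkl)
        moreover have "fiber_edge P \<pi> \<nu> p j k = \<epsilon>" "fiber_edge P \<pi> \<nu> p j l = \<epsilon>'"
          using fiber_edge_eqI[OF \<epsilon> v] fiber_edge_eqI[OF \<epsilon>'(1) v'] \<epsilon>'(2) by (simp_all add: jkl)
        ultimately have conn: "conn P \<epsilon> \<epsilon>' = fiber_edge P \<pi> \<nu> p k l"
          using standard_conn[OF p in_range] by simp
        note f = fiber_edge[OF p in_range(2,3) \<open>k \<noteq> l\<close>]
        have "edge_name (conn P \<epsilon> \<epsilon>') = Vert p k l"
          unfolding conn using edge_name_simps(1)[OF f(2)] f(3,4) vertex_at(3)[OF p] in_range
          by simp
        then show ?thesis
          using \<open>k \<noteq> l\<close> by (simp add: edge_name_simps(1)[OF v] edge_name_simps(1)[OF v'] jkl)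
      qed
    next
      case h': (Inr e')
      have "emap \<pi> (conn P \<epsilon> \<epsilon>') = Inr e'"
        using conn_covers_vertical[OF \<epsilon> star] v h' by (simp add: vertical_def horizontal_def)
      then show ?thesis
        using c(2) by (simp add: edge_name_simps(1)[OF v] edge_name_simps(2) h')
    qed
  next
    case h: (Inr e)
    note \<sigma> = legmap_horizontal[OF \<epsilon> h]
    show ?thesis
    proof (cases "emap \<pi> \<epsilon>'")
      case v': (Inl p)
      have "vmap \<pi> (ter P \<epsilon>') = ini \<Gamma> e"
        using vertical_ends[OF \<epsilon>'(1) v'] horizontal_ini(2)[OF \<epsilon> h] \<epsilon>'(2) by simp
      then have "legmap (section_legs s) e (\<nu> (ter P \<epsilon>')) = \<nu> (transport P \<pi> e (ter P \<epsilon>'))"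
        using legmap_\<nu> \<epsilon>'(1) by simp
      then show ?thesis
        using conn_horizontal_vertical[OF \<epsilon> h \<epsilon>'(1) v' \<epsilon>'(2)] c(2) \<sigma>
        by (simp add: edge_name_simps(1)[OF v'] edge_name_simps(1) edge_name_simps(2)[OF h])
    next
      case h': (Inr e')
      then show ?thesis
        using conn_covers_horizontal[OF \<epsilon> star h h'] c(2) \<sigma>
        by (simp add: edge_name_simps(2) h)
    qed
  qed
qed

lemma section_legs_projectivization:
  assumes "\<And>p. p \<in> Vs \<Gamma> \<Longrightarrow> s p \<in> Vs P"
  shows "same_fibration P \<pi> (projectivization \<Gamma> (r + 1) (section_legs s)) proj_map
    (\<lambda>x. (vmap \<pi> x, \<nu> x)) edge_name"
proof -
  let ?Q = "projectivization \<Gamma> (r + 1) (section_legs s)"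
  let ?f = "\<lambda>x. (vmap \<pi> x, \<nu> x)"
  have ends: "ini ?Q (edge_name \<epsilon>) = ?f (ini P \<epsilon>) \<and> ter ?Q (edge_name \<epsilon>) = ?f (ter P \<epsilon>)"
    if \<epsilon>: "\<epsilon> \<in> Es P" for \<epsilon>
  proof (cases "emap \<pi> \<epsilon>")
    case (Inl p)
    then show ?thesis
      using vertical_ends[OF \<epsilon> Inl] by (simp add: projectivization_def edge_name_simps(1))
  next
    case (Inr e)
    then show ?thesis
      using horizontal_ini[OF \<epsilon> Inr] horizontal_ter[OF \<epsilon> Inr] legmap_horizontal[OF \<epsilon> Inr]
      by (simp add: projectivization_def edge_name_simps(2))
  qed
  have "bij_betw ?f (Vs P) (Vs ?Q)"
    using vertex_name_bij by (simp add: projectivization_def)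
  moreover have "bij_betw edge_name (Es P) (Es ?Q)"
    unfolding bij_betw_def using edge_name_inj edge_name_image by blast
  moreover have "edge_name (rev_arc P \<epsilon>) = rev_arc ?Q (edge_name \<epsilon>)" if "\<epsilon> \<in> Es P" for \<epsilon>
    using edge_name_rev[OF that] by (simp add: projectivization_def)
  ultimately have "graph_iso P ?Q ?f edge_name"
    using ends unfolding graph_iso_def by blast
  moreover have "axial ?Q (edge_name \<epsilon>) = id (axial P \<epsilon>)" if "\<epsilon> \<in> Es P" for \<epsilon>
    using edge_name_axial[OF assms that] by (simp add: projectivization_def)
  moreover have "edge_name (conn P \<epsilon> \<epsilon>') = conn ?Q (edge_name \<epsilon>) (edge_name \<epsilon>')"
    if "\<epsilon> \<in> Es P" "\<epsilon>' \<in> star P (ini P \<epsilon>)" for \<epsilon> \<epsilon>'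
    using edge_name_conn[of \<epsilon> \<epsilon>' s] that by (simp add: projectivization_def)
  ultimately have "gkm_iso id P ?Q ?f edge_name"
    unfolding gkm_iso_def by blast
  then show ?thesis
    by (auto simp: same_fibration_def proj_map_def edge_name_def split: sum.splits)
qed

end


section \<open>Base points of an invariant section\<close>

text \<open>
  The edge of the section over \<open>e\<close> is the lift of \<open>e\<close> at the base point over \<open>i(e)\<close>, because its
  initial vertex is the only vertex of the section over \<open>i(e)\<close>; likewise for its terminal vertex.
\<close>

lemma (in gkm_fibration) invariant_section_parallel:
  assumes "invariant_section P \<Gamma> \<pi> S"
  obtains s where "\<And>p. p \<in> Vs \<Gamma> \<Longrightarrow> s p \<in> Vs P \<and> vmap \<pi> (s p) = p"
    and "\<And>e. e \<in> Es \<Gamma> \<Longrightarrow> transport P \<pi> e (s (ini \<Gamma> e)) = s (ter \<Gamma> e)"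
proof -
  have sub: "subgraph S (dgr P)"
    and bv: "bij_betw (vmap \<pi>) (verts S) (Vs \<Gamma>)"
    and be: "bij_betw (emap \<pi>) (arcs S) (Inr ` Es \<Gamma>)"
    using assms by (simp_all add: invariant_section_def)
  interpret S: wf_digraph S
    using sub by (rule subgraphE)
  have S: "verts S \<subseteq> Vs P" "arcs S \<subseteq> Es P" "tail S = ini P" "head S = ter P"
    using sub by (auto simp: subgraph_def compatible_def)
  define s where "s = inv_into (verts S) (vmap \<pi>)"
  have s: "s (vmap \<pi> x) = x" if "x \<in> verts S" for x
    using bij_betw_inv_into_left[OF bv that] by (simp add: s_def)
  have s': "s p \<in> verts S" "vmap \<pi> (s p) = p" if "p \<in> Vs \<Gamma>" for p
    using bij_betw_inv_into_right[OF bv that] bij_betwE[OF bij_betw_inv_into[OF bv]] that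
    by (auto simp: s_def)
  show thesis
  proof
    show "s p \<in> Vs P \<and> vmap \<pi> (s p) = p" if "p \<in> Vs \<Gamma>" for p
      using s'[OF that] S(1) by blast
    fix e assume "e \<in> Es \<Gamma>"
    then have "Inr e \<in> emap \<pi> ` arcs S"
      using be by (simp add: bij_betw_def)
    then obtain h where h: "h \<in> arcs S" "emap \<pi> h = Inr e" by auto
    then have hP: "h \<in> Es P"
      using S(2) by blast
    have "ini P h \<in> verts S" "ter P h \<in> verts S"
      using S.tail_in_verts[OF h(1)] S.head_in_verts[OF h(1)] S(3,4) by simp_all
    then have "s (ini \<Gamma> e) = ini P h" "s (ter \<Gamma> e) = ter P h"
      using s horizontal_ini(2)[OF hP h(2)] horizontal_ter[OF hP h(2)] by metis+
    then show "transport P \<pi> e (s (ini \<Gamma> e)) = s (ter \<Gamma> e)"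
      using transport_eqI[OF hP h(2)] by simp
  qed
qed

theorem proposition6p10:
  fixes P :: "('w, 'f, 'n::finite) gkm_data"
    and \<Gamma> :: "('v, 'e, 'n) gkm_data"
    and \<pi> :: "('w, 'f, 'v, 'e) graph_map"
    and m' m r :: nat
    and \<nu> :: "'w \<Rightarrow> nat"
    and S :: "('w, 'f) pre_digraph"
  assumes "projective_gkm_fiber_bundle P m' \<Gamma> m \<pi> r \<nu>"
    and "invariant_section P \<Gamma> \<pi> S"
  shows "\<exists>\<xi> :: ('v, 'e, 'n) leg_data. leg_bundle \<Gamma> m (r + 1) \<xi> \<and>
    (\<exists>g. same_fibration P \<pi> (projectivization \<Gamma> (r + 1) \<xi>) proj_map (\<lambda>x. (vmap \<pi> x, \<nu> x)) g)"
proof -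
  interpret projective_gkm_fiber_bundle P m' \<Gamma> m \<pi> r \<nu>
    by (rule assms(1))
  obtain s where s: "\<And>p. p \<in> Vs \<Gamma> \<Longrightarrow> s p \<in> Vs P \<and> vmap \<pi> (s p) = p"
    and parallel: "\<And>e. e \<in> Es \<Gamma> \<Longrightarrow> transport P \<pi> e (s (ini \<Gamma> e)) = s (ter \<Gamma> e)"
    using invariant_section_parallel[OF assms(2)] by blast
  show ?thesis
    using section_legs_bundle[OF s parallel] section_legs_projectivization[of s] s by blast
qed

end
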